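(* Let $n\ge 1$ and let $a_1\le a_2\le\cdots\le a_n$ be real numbers, not all zero. Any solvmanifold of the group $G_{(a_1,\ldots,a_n)}$ (i.e. any quotient $\Gamma\backslash G_{(a_1,\ldots,a_n)}$ by a lattice $\Gamma$) admits invariant Vaisman structures. In particular, any oscillator solvmanifold (the case $0<a_1\le\cdots\le a_n$) admits invariant Vaisman structures.
   Context: Let $\mathfrak{h}_{2n+1}$ be the Heisenberg Lie algebra with basis $\{B,e_1,f_1,\dots,e_n,f_n\}$ and nonzero brackets $[e_i,f_i]=B$. $\mathfrak{g}_{(a_1,\ldots,a_n)}=\mathbb{R}A\ltimes_D\mathfrak{h}_{2n+1}$ is the Lie algebra with $[A,x]=Dx$ for $x\in\mathfrak{h}_{2n+1}$, where $DB=0$, $De_i=a_if_i$, $Df_i=-a_ie_i$. $G_{(a_1,\ldots,a_n)}$ is the simply connected Lie group with Lie algebra $\mathfrak{g}_{(a_1,\ldots,a_n)}$; when $0<a_1\le\cdots\le a_n$ it is called an oscillator group. A lattice is a discrete subgroup $\Gamma$ with $\Gamma\backslash G$ compact. An invariant Vaisman structure on $\Gamma\backslash G$ is a Vaisman structure induced by a left invariant one on $G$, equivalently by a Vaisman structure on the Lie algebra $\mathfrak{g}$ of $G$: an endomorphism $J$ with $J^2=-\mathrm{Id}$ and $[Jx,Jy]-[x,y]-J([Jx,y]+[x,Jy])=0$, together with a Hermitian inner product $\langle\cdot,\cdot\rangle$, such that, with $\omega(x,y)=\langle Jx,y\rangle$, there is a nonzero $\theta\in\mathfrak{g}^*$ (the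 Lee form) with $d\theta=0$, $d\omega=\theta\wedge\omega$ and $\nabla\theta=0$, where $d$ is the Chevalley–Eilenberg differential and $\nabla$ the Levi-Civita connection of $\langle\cdot,\cdot\rangle$. *)

theory Defs
  imports "HOL-Analysis.Analysis" "HOL-Algebra.Coset"
begin

section \<open>Vaisman structures on a Lie algebra\<close>

text \<open>
  A real Lie algebra is given by its underlying vector space (a type) and its bracket \<open>br\<close>.
  The Chevalley--Eilenberg differential is needed only in degrees 1 and 2.
\<close>

definition ce_d1 :: "('g \<Rightarrow> 'g \<Rightarrow> 'g) \<Rightarrow> ('g \<Rightarrow> real) \<Rightarrow> 'g \<Rightarrow> 'g \<Rightarrow> real" where
  "ce_d1 br \<alpha> x y = - \<alpha> (br x y)"

definition ce_d2 :: "('g \<Rightarrow> 'g \<Rightarrow> 'g) \<Rightarrow> ('g \<Rightarrow> 'g \<Rightarrow> real) \<Rightarrow> 'g \<Rightarrow> 'g \<Rightarrow> 'g \<Rightarrow> real" where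
  "ce_d2 br \<omega> x y z = - \<omega> (br x y) z + \<omega> (br x z) y - \<omega> (br y z) x"

definition wedge12 :: "('g \<Rightarrow> real) \<Rightarrow> ('g \<Rightarrow> 'g \<Rightarrow> real) \<Rightarrow> 'g \<Rightarrow> 'g \<Rightarrow> 'g \<Rightarrow> real" where
  "wedge12 \<theta> \<omega> x y z = \<theta> x * \<omega> y z - \<theta> y * \<omega> x z + \<theta> z * \<omega> x y"

definition inner_product_on :: "('g::real_vector \<Rightarrow> 'g \<Rightarrow> real) \<Rightarrow> bool" where
  "inner_product_on ip \<longleftrightarrow>
     (\<forall>x. linear (ip x)) \<and> (\<forall>x y. ip x y = ip y x) \<and> (\<forall>x. x \<noteq> 0 \<longrightarrow> 0 < ip x x)"

definition complex_structure :: "('g::real_vector \<Rightarrow> 'g \<Rightarrow> 'g) \<Rightarrow> ('g \<Rightarrow> 'g) \<Rightarrow> bool" where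
  "complex_structure br J \<longleftrightarrow> linear J \<and> (\<forall>x. J (J x) = - x) \<and>
     (\<forall>x y. br (J x) (J y) - br x y - J (br (J x) y + br x (J y)) = 0)"

text \<open>
  The Levi-Civita connection of the left invariant metric determined by \<open>ip\<close>: \<open>nabla x y\<close> is the
  covariant derivative of \<open>y\<close> along \<open>x\<close>. It is the unique metric torsion-free connection.
\<close>

definition levi_civita ::
  "('g::real_vector \<Rightarrow> 'g \<Rightarrow> 'g) \<Rightarrow> ('g \<Rightarrow> 'g \<Rightarrow> real) \<Rightarrow> ('g \<Rightarrow> 'g \<Rightarrow> 'g) \<Rightarrow> bool" where
  "levi_civita br ip nabla \<longleftrightarrow>
     (\<forall>x. linear (nabla x)) \<and> (\<forall>y. linear (\<lambda>x. nabla x y)) \<and>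
     (\<forall>x y. nabla x y - nabla y x = br x y) \<and>
     (\<forall>x y z. ip (nabla x y) z + ip y (nabla x z) = 0)"

text \<open>
  In the last clause, \<open>(nabla x \<theta>) y = - \<theta> (nabla x y)\<close> on left invariant fields.
\<close>

definition vaisman_structure ::
  "('g::real_vector \<Rightarrow> 'g \<Rightarrow> 'g) \<Rightarrow> ('g \<Rightarrow> 'g) \<Rightarrow> ('g \<Rightarrow> 'g \<Rightarrow> real) \<Rightarrow> bool" where
  "vaisman_structure br J ip \<longleftrightarrow>
     complex_structure br J \<and> inner_product_on ip \<and> (\<forall>x y. ip (J x) (J y) = ip x y) \<and>
     (let \<omega> = (\<lambda>x y. ip (J x) y) in
      \<exists>\<theta>. linear \<theta> \<and> (\<exists>x. \<theta> x \<noteq> 0) \<and>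
        (\<forall>x y. ce_d1 br \<theta> x y = 0) \<and>
        (\<forall>x y z. ce_d2 br \<omega> x y z = wedge12 \<theta> \<omega> x y z) \<and>
        (\<exists>nabla. levi_civita br ip nabla \<and> (\<forall>x y. - \<theta> (nabla x y) = 0)))"


section \<open>Lie groups with a global chart, and their quotients\<close>

text \<open>
  Every simply connected solvable Lie group is diffeomorphic to a Euclidean space, so we take
  groups whose carrier is a whole Euclidean space \<open>'g\<close>. Every tangent space is then \<open>'g\<close>, and the
  tangent bundle is \<open>'g \<times> 'g\<close>.
\<close>

definition left_transl_deriv ::
  "('g::real_normed_vector, 'b) monoid_scheme \<Rightarrow> 'g \<Rightarrow> 'g \<Rightarrow> 'g \<Rightarrow> 'g" where
  "left_transl_deriv G p q = frechet_derivative (\<lambda>x. p \<otimes>\<^bsub>G\<^esub> x) (at q)"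

definition left_inv_field ::
  "('g::real_normed_vector, 'b) monoid_scheme \<Rightarrow> 'g \<Rightarrow> 'g \<Rightarrow> 'g" where
  "left_inv_field G x p = left_transl_deriv G p \<one>\<^bsub>G\<^esub> x"

text \<open>
  The bracket of the Lie algebra of \<open>G\<close>: the commutator \<open>[X, Y] = DY X - DX Y\<close> of the left
  invariant vector fields extending \<open>x\<close> and \<open>y\<close>, evaluated at the identity.
\<close>

definition lie_bracket ::
  "('g::real_normed_vector, 'b) monoid_scheme \<Rightarrow> 'g \<Rightarrow> 'g \<Rightarrow> 'g" where
  "lie_bracket G x y =
     frechet_derivative (left_inv_field G y) (at \<one>\<^bsub>G\<^esub>) (left_inv_field G x \<one>\<^bsub>G\<^esub>)
   - frechet_derivative (left_inv_field G x) (at \<one>\<^bsub>G\<^esub>) (left_inv_field G y \<one>\<^bsub>G\<^esub>)"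

text \<open>
  The space \<open>\<Gamma>\G\<close>, whose points are the cosets \<open>\<Gamma> p\<close>, with the quotient topology.
\<close>

definition coset_topology ::
  "('g::topological_space, 'b) monoid_scheme \<Rightarrow> 'g set \<Rightarrow> 'g set topology" where
  "coset_topology G \<Gamma> =
     topology (\<lambda>U. U \<subseteq> rcosets\<^bsub>G\<^esub> \<Gamma> \<and>
       openin (top_of_set (carrier G)) {p \<in> carrier G. \<Gamma> #>\<^bsub>G\<^esub> p \<in> U})"

lemma openin_coset_topology:
  "openin (coset_topology G \<Gamma>) U \<longleftrightarrow> U \<subseteq> rcosets\<^bsub>G\<^esub> \<Gamma> \<and>
     openin (top_of_set (carrier G)) {p \<in> carrier G. \<Gamma> #>\<^bsub>G\<^esub> p \<in> U}"
proof -
  have "istopology (\<lambda>U. U \<subseteq> rcosets\<^bsub>G\<^esub> \<Gamma> \<and>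
       openin (top_of_set (carrier G)) {p \<in> carrier G. \<Gamma> #>\<^bsub>G\<^esub> p \<in> U})" (is "istopology ?P")
    unfolding istopology_def
  proof (intro conjI allI impI)
    fix S T assume "?P S" "?P T"
    moreover have "{p \<in> carrier G. \<Gamma> #>\<^bsub>G\<^esub> p \<in> S \<inter> T} =
        {p \<in> carrier G. \<Gamma> #>\<^bsub>G\<^esub> p \<in> S} \<inter> {p \<in> carrier G. \<Gamma> #>\<^bsub>G\<^esub> p \<in> T}" by auto
    ultimately show "S \<inter> T \<subseteq> rcosets\<^bsub>G\<^esub> \<Gamma>"
      "openin (top_of_set (carrier G)) {p \<in> carrier G. \<Gamma> #>\<^bsub>G\<^esub> p \<in> S \<inter> T}"
      by (auto simp del: Int_iff)
  next
    fix \<K> assume K: "\<forall>K\<in>\<K>. ?P K"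
    have "{p \<in> carrier G. \<Gamma> #>\<^bsub>G\<^esub> p \<in> \<Union>\<K>} =
        (\<Union>K\<in>\<K>. {p \<in> carrier G. \<Gamma> #>\<^bsub>G\<^esub> p \<in> K})" by auto
    then show "openin (top_of_set (carrier G)) {p \<in> carrier G. \<Gamma> #>\<^bsub>G\<^esub> p \<in> \<Union>\<K>}"
      using K by (auto simp del: Union_iff)
    show "\<Union>\<K> \<subseteq> rcosets\<^bsub>G\<^esub> \<Gamma>" using K by blast
  qed
  then show ?thesis
    by (simp add: coset_topology_def topology_inverse')
qed

lemma topspace_coset_topology: "topspace (coset_topology G \<Gamma>) = rcosets\<^bsub>G\<^esub> \<Gamma>"
proof
  show "topspace (coset_topology G \<Gamma>) \<subseteq> rcosets\<^bsub>G\<^esub> \<Gamma>"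
    using openin_coset_topology[of G \<Gamma> "topspace (coset_topology G \<Gamma>)"] by simp
  have "{p \<in> carrier G. \<Gamma> #>\<^bsub>G\<^esub> p \<in> rcosets\<^bsub>G\<^esub> \<Gamma>} = carrier G"
    by (auto simp: RCOSETS_def)
  then have "openin (coset_topology G \<Gamma>) (rcosets\<^bsub>G\<^esub> \<Gamma>)"
    unfolding openin_coset_topology by simp
  then show "rcosets\<^bsub>G\<^esub> \<Gamma> \<subseteq> topspace (coset_topology G \<Gamma>)"
    by (rule openin_subset)
qed

lemma quotient_map_coset_topology:
  "quotient_map (top_of_set (carrier G)) (coset_topology G \<Gamma>) (\<lambda>p. \<Gamma> #>\<^bsub>G\<^esub> p)"
  unfolding quotient_map_def topspace_coset_topology
  by (auto simp: openin_coset_topology RCOSETS_def)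

definition cocompact_lattice :: "('g::topological_space, 'b) monoid_scheme \<Rightarrow> 'g set \<Rightarrow> bool" where
  "cocompact_lattice G \<Gamma> \<longleftrightarrow>
     subgroup \<Gamma> G \<and> discrete \<Gamma> \<and> compact_space (coset_topology G \<Gamma>)"

text \<open>
  Points of the tangent bundle of \<open>\<Gamma>\G\<close>: orbits of tangent vectors \<open>(p, v)\<close> of \<open>G\<close> under the
  derivatives of the left translations by elements of \<open>\<Gamma>\<close>. Thus \<open>quotient_tangent G \<Gamma> p v\<close> is the
  image of \<open>v\<close> under the derivative at \<open>p\<close> of the covering \<open>G \<rightarrow> \<Gamma>\G\<close>.
\<close>

definition quotient_tangent ::
  "('g::real_normed_vector, 'b) monoid_scheme \<Rightarrow> 'g set \<Rightarrow> 'g \<Rightarrow> 'g \<Rightarrow> ('g \<times> 'g) set" where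
  "quotient_tangent G \<Gamma> p v = (\<lambda>\<gamma>. (\<gamma> \<otimes>\<^bsub>G\<^esub> p, left_transl_deriv G \<gamma> p v)) ` \<Gamma>"

text \<open>
  An invariant Vaisman structure on \<open>\<Gamma>\G\<close>: an endomorphism \<open>JQ\<close> of the tangent bundle of \<open>\<Gamma>\G\<close> and a
  metric \<open>gQ\<close> on it whose pullbacks to \<open>G\<close> are the left invariant tensors extending a Vaisman
  structure \<open>(J, ip)\<close> on the Lie algebra of \<open>G\<close>. The values of \<open>JQ\<close> and \<open>gQ\<close> are irrelevant
  outside the tangent bundle, resp. on pairs of vectors with different base points.
\<close>

definition invariant_vaisman_structure ::
  "('g::real_normed_vector, 'b) monoid_scheme \<Rightarrow> 'g set \<Rightarrow>
     (('g \<times> 'g) set \<Rightarrow> ('g \<times> 'g) set) \<Rightarrow> (('g \<times> 'g) set \<Rightarrow> ('g \<times> 'g) set \<Rightarrow> real) \<Rightarrow> bool" where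
  "invariant_vaisman_structure G \<Gamma> JQ gQ \<longleftrightarrow>
     (\<exists>J ip. vaisman_structure (lie_bracket G) J ip \<and>
        (\<forall>p \<in> carrier G. \<forall>x.
           JQ (quotient_tangent G \<Gamma> p (left_inv_field G x p)) =
           quotient_tangent G \<Gamma> p (left_inv_field G (J x) p)) \<and>
        (\<forall>p \<in> carrier G. \<forall>x y.
           gQ (quotient_tangent G \<Gamma> p (left_inv_field G x p))
              (quotient_tangent G \<Gamma> p (left_inv_field G y p)) = ip x y))"


section \<open>The Lie algebra and the group\<close>

text \<open>
  Coordinates: \<open>(b, x, y)\<close> is \<open>b B + (\<Sum>i. x i e i + y i f i)\<close>, and \<open>(t, h)\<close> is \<open>t A + h\<close>.
\<close>

type_synonym 'n heis = "real \<times> (real^'n) \<times> (real^'n)"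

definition heis_bracket :: "'n::finite heis \<Rightarrow> 'n heis \<Rightarrow> 'n heis" where
  "heis_bracket = (\<lambda>(b, x, y) (b', x', y'). (x \<bullet> y' - y \<bullet> x', 0, 0))"

definition osc_deriv :: "real^'n::finite \<Rightarrow> 'n heis \<Rightarrow> 'n heis" where
  "osc_deriv a = (\<lambda>(b, x, y). (0, \<chi> i. - (a$i * y$i), \<chi> i. a$i * x$i))"

definition osc_bracket ::
  "real^'n::finite \<Rightarrow> real \<times> 'n heis \<Rightarrow> real \<times> 'n heis \<Rightarrow> real \<times> 'n heis" where
  "osc_bracket a = (\<lambda>(s, h) (t, k).
     (0, s *\<^sub>R osc_deriv a k - t *\<^sub>R osc_deriv a h + heis_bracket h k))"

text \<open>
  The Heisenberg group is written in exponential coordinates, \<open>osc_exp a t\<close> is the automorphism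
  \<open>exp (t D)\<close> of it, and the group is the semidirect product of the reals and the Heisenberg group
  along it. Its carrier is a Euclidean space, so it is simply connected.
\<close>

definition heis_mult :: "'n::finite heis \<Rightarrow> 'n heis \<Rightarrow> 'n heis" where
  "heis_mult h k = h + k + (1/2) *\<^sub>R heis_bracket h k"

definition osc_exp :: "real^'n::finite \<Rightarrow> real \<Rightarrow> 'n heis \<Rightarrow> 'n heis" where
  "osc_exp a t = (\<lambda>(b, x, y). (b,
     \<chi> i. cos (t * a$i) * x$i - sin (t * a$i) * y$i,
     \<chi> i. sin (t * a$i) * x$i + cos (t * a$i) * y$i))"

definition osc_group :: "real^'n::finite \<Rightarrow> (real \<times> 'n heis) monoid" where
  "osc_group a =
     \<lparr>carrier = UNIV,
      monoid.mult = (\<lambda>(s, h) (t, k). (s + t, heis_mult h (osc_exp a s k))),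
      one = (0, 0)\<rparr>"

lemma osc_exp_0 [simp]: "osc_exp a 0 h = h"
  by (cases h) (simp add: osc_exp_def vec_eq_iff)

lemma osc_exp_add: "osc_exp a s (osc_exp a t h) = osc_exp a (s + t) h"
  by (cases h) (simp add: osc_exp_def vec_eq_iff cos_add sin_add algebra_simps)

lemma linear_osc_exp: "linear (osc_exp a t)"
proof (rule linearI)
  fix h k :: "'a heis" and r :: real
  show "osc_exp a t (h + k) = osc_exp a t h + osc_exp a t k"
    by (cases h; cases k) (simp add: osc_exp_def vec_eq_iff algebra_simps)
  show "osc_exp a t (r *\<^sub>R h) = r *\<^sub>R osc_exp a t h"
    by (cases h) (simp add: osc_exp_def vec_eq_iff algebra_simps)
qed

lemma bilinear_heis_bracket: "bilinear heis_bracket"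
  by (auto simp: bilinear_def heis_bracket_def algebra_simps inner_simps
      intro!: linearI split: prod.splits)

lemma osc_exp_heis_bracket:
  "heis_bracket (osc_exp a t h) (osc_exp a t k) = osc_exp a t (heis_bracket h k)"
proof -
  obtain b x y b' x' y' where [simp]: "h = (b, x, y)" "k = (b', x', y')"
    by (metis prod_cases3)
  have *: "(C*x - S*y)*(S*x'+C*y') - (S*x+C*y)*(C*x'-S*y') = (x*y' - y*x')"
    if "C\<^sup>2 + S\<^sup>2 = 1" for C S x y x' y' :: real
  proof -
    have "(C*x - S*y)*(S*x'+C*y') - (S*x+C*y)*(C*x'-S*y') = (C\<^sup>2 + S\<^sup>2) * (x*y' - y*x')"
      by (simp add: algebra_simps power2_eq_square)
    then show ?thesis using that by simp
  qed
  show ?thesis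
    by (simp add: osc_exp_def heis_bracket_def vec_eq_iff inner_vec_def sum_subtractf[symmetric] *)
qed

lemma osc_exp_heis_mult:
  "osc_exp a t (heis_mult h k) = heis_mult (osc_exp a t h) (osc_exp a t k)"
  by (simp add: heis_mult_def osc_exp_heis_bracket linear_add[OF linear_osc_exp]
      linear_cmul[OF linear_osc_exp])

lemma heis_mult_assoc: "heis_mult (heis_mult h k) l = heis_mult h (heis_mult k l)"
  by (cases h; cases k; cases l)
     (simp add: heis_mult_def heis_bracket_def inner_simps algebra_simps)

lemma mult_osc_group:
  "(s, h) \<otimes>\<^bsub>osc_group a\<^esub> (t, k) = (s + t, heis_mult h (osc_exp a s k))"
  and one_osc_group: "\<one>\<^bsub>osc_group a\<^esub> = 0"
  and carrier_osc_group: "carrier (osc_group a) = UNIV"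
  by (simp_all add: osc_group_def zero_prod_def)

lemma group_osc_group: "group (osc_group a)"
proof (rule groupI)
  fix x y z :: "real \<times> 'a heis"
  show "x \<otimes>\<^bsub>osc_group a\<^esub> y \<otimes>\<^bsub>osc_group a\<^esub> z = x \<otimes>\<^bsub>osc_group a\<^esub> (y \<otimes>\<^bsub>osc_group a\<^esub> z)"
    by (cases x; cases y; cases z)
      (simp only: mult_osc_group osc_exp_heis_mult osc_exp_add heis_mult_assoc add.assoc)
  show "\<one>\<^bsub>osc_group a\<^esub> \<otimes>\<^bsub>osc_group a\<^esub> x = x"
    by (cases x) (simp add: one_osc_group zero_prod_def mult_osc_group heis_mult_def heis_bracket_def
        split: prod.splits)
  obtain s h where x: "x = (s, h)" by (cases x)
  have "(- s, - osc_exp a (- s) h) \<otimes>\<^bsub>osc_group a\<^esub> x = \<one>\<^bsub>osc_group a\<^esub>"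
    by (simp add: x mult_osc_group one_osc_group heis_mult_def heis_bracket_def inner_commute zero_prod_def
        split: prod.splits)
  then show "\<exists>y\<in>carrier (osc_group a). y \<otimes>\<^bsub>osc_group a\<^esub> x = \<one>\<^bsub>osc_group a\<^esub>"
    by (metis UNIV_I carrier_osc_group)
qed (simp_all add: carrier_osc_group)

lemma left_transl_deriv_osc_group:
  "left_transl_deriv (osc_group a) (s, h) q (t, k) =
     (t, osc_exp a s k + (1/2) *\<^sub>R heis_bracket h (osc_exp a s k))"
proof -
  let ?L = "\<lambda>v. (fst v, osc_exp a s (snd v) + (1/2) *\<^sub>R heis_bracket h (osc_exp a s (snd v)))"
  have lin: "linear (\<lambda>k. heis_bracket h k)"
    using bilinear_heis_bracket unfolding bilinear_def by blast
  have "linear ?L"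
    by (rule linearI)
      (simp_all add: linear_add[OF linear_osc_exp] linear_cmul[OF linear_osc_exp]
        linear_add[OF lin] linear_cmul[OF lin] algebra_simps)
  then have "(?L has_derivative ?L) (at q)"
    by (rule bounded_linear_imp_has_derivative[OF linear_conv_bounded_linear[THEN iffD1]])
  then have "((\<lambda>v. (s, h) + ?L v) has_derivative ?L) (at q)"
    using has_derivative_add[OF has_derivative_const[of "(s, h)"], of ?L ?L "at q"]
    by (simp only: add_0_left)
  moreover have "(\<lambda>v. (s, h) \<otimes>\<^bsub>osc_group a\<^esub> v) = (\<lambda>v. (s, h) + ?L v)"
    by (auto simp: fun_eq_iff mult_osc_group heis_mult_def)
  ultimately have "((\<lambda>v. (s, h) \<otimes>\<^bsub>osc_group a\<^esub> v) has_derivative ?L) (at q)"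
    by simp
  then show ?thesis
    unfolding left_transl_deriv_def by (simp add: frechet_derivative_at[symmetric])
qed

lemma osc_exp_has_derivative:
  "((\<lambda>t. osc_exp a t h) has_derivative (\<lambda>\<sigma>. \<sigma> *\<^sub>R osc_deriv a h)) (at 0)"
proof -
  obtain b x y where h: "h = (b, x, y)" by (metis prod_cases3)
  have vec: "((\<lambda>t. \<chi> i. F i t) has_derivative (\<lambda>\<sigma>. \<sigma> *\<^sub>R (\<chi> i. F' i))) (at 0)"
    if F: "\<And>i. (F i has_real_derivative F' i) (at 0)"
    for F :: "'a \<Rightarrow> real \<Rightarrow> real" and F' :: "'a \<Rightarrow> real"
  proof (subst has_derivative_componentwise_within, intro ballI)
    fix u :: "real^'a" assume "u \<in> Basis"
    then obtain i where u: "u = axis i 1" by (auto simp: Basis_vec_def)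
    show "((\<lambda>t. (\<chi> i. F i t) \<bullet> u) has_derivative (\<lambda>\<sigma>. (\<sigma> *\<^sub>R (\<chi> i. F' i)) \<bullet> u)) (at 0)"
      using F[of i] by (simp add: u inner_axis has_field_derivative_def mult_commute_abs)
  qed
  have 1: "((\<lambda>t. \<chi> i. cos (t * a$i) * x$i - sin (t * a$i) * y$i) has_derivative
        (\<lambda>\<sigma>. \<sigma> *\<^sub>R (\<chi> i. - (a$i * y$i)))) (at 0)"
    by (rule vec) (auto intro!: derivative_eq_intros)
  have 2: "((\<lambda>t. \<chi> i. sin (t * a$i) * x$i + cos (t * a$i) * y$i) has_derivative
        (\<lambda>\<sigma>. \<sigma> *\<^sub>R (\<chi> i. a$i * x$i))) (at 0)"
    by (rule vec) (auto intro!: derivative_eq_intros)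
  have "((\<lambda>t. (b, (\<chi> i. cos (t * a$i) * x$i - sin (t * a$i) * y$i),
        (\<chi> i. sin (t * a$i) * x$i + cos (t * a$i) * y$i))) has_derivative
      (\<lambda>\<sigma>. (0, \<sigma> *\<^sub>R (\<chi> i. - (a$i * y$i)), \<sigma> *\<^sub>R (\<chi> i. a$i * x$i)))) (at 0)"
    by (intro has_derivative_Pair has_derivative_const 1 2)
  then show ?thesis by (simp add: h osc_exp_def osc_deriv_def)
qed

lemma left_inv_field_has_derivative:
  "(left_inv_field (osc_group a) (t, k) has_derivative
     (\<lambda>(\<sigma>, \<eta>). (0, \<sigma> *\<^sub>R osc_deriv a k + (1/2) *\<^sub>R heis_bracket \<eta> k))) (at 0)"
proof -
  have bb: "bounded_bilinear (heis_bracket :: 'a heis \<Rightarrow> _)"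
    using bilinear_heis_bracket by (simp add: bilinear_conv_bounded_bilinear)
  have e: "((\<lambda>p :: real \<times> 'a heis. osc_exp a (fst p) k) has_derivative
      (\<lambda>v. fst v *\<^sub>R osc_deriv a k)) (at 0)"
    using has_derivative_compose[OF has_derivative_fst[OF has_derivative_ident],
        of "\<lambda>t. osc_exp a t k" "\<lambda>\<sigma>. \<sigma> *\<^sub>R osc_deriv a k" 0 UNIV] osc_exp_has_derivative[of a k]
    by simp
  have "((\<lambda>p. (t, osc_exp a (fst p) k + (1/2) *\<^sub>R heis_bracket (snd p) (osc_exp a (fst p) k)))
      has_derivative (\<lambda>v. (0, fst v *\<^sub>R osc_deriv a k
        + (1/2) *\<^sub>R (heis_bracket (snd (0 :: real \<times> 'a heis)) (fst v *\<^sub>R osc_deriv a k)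
          + heis_bracket (snd v) (osc_exp a (fst (0 :: real \<times> 'a heis)) k))))) (at 0)"
    by (intro has_derivative_Pair has_derivative_const has_derivative_add e
        has_derivative_scaleR_right bounded_bilinear.FDERIV[OF bb] has_derivative_snd
        has_derivative_ident)
  moreover have "left_inv_field (osc_group a) (t, k) =
      (\<lambda>p. (t, osc_exp a (fst p) k + (1/2) *\<^sub>R heis_bracket (snd p) (osc_exp a (fst p) k)))"
    by (auto simp: fun_eq_iff left_inv_field_def left_transl_deriv_osc_group)
  ultimately show ?thesis
    by (simp add: bounded_bilinear.zero_left[OF bb] case_prod_beta')
qed

text \<open>The Lie algebra of the group is the one given by \<open>osc_bracket\<close>.\<close>

lemma lie_bracket_osc_group: "lie_bracket (osc_group a) = osc_bracket a"
proof (intro ext)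
  fix v w :: "real \<times> 'a heis"
  obtain s h t k where vw: "v = (s, h)" "w = (t, k)" by (metis surj_pair)
  have anti: "heis_bracket k h = - heis_bracket h k"
    by (cases h; cases k) (simp add: heis_bracket_def inner_commute)
  have one: "left_inv_field (osc_group a) u \<one>\<^bsub>osc_group a\<^esub> = u" for u
    by (cases u) (simp add: left_inv_field_def one_osc_group zero_prod_def
        left_transl_deriv_osc_group heis_bracket_def split: prod.splits)
  have der: "frechet_derivative (left_inv_field (osc_group a) (t, k)) (at \<one>\<^bsub>osc_group a\<^esub>) =
     (\<lambda>(\<sigma>, \<eta>). (0, \<sigma> *\<^sub>R osc_deriv a k + (1/2) *\<^sub>R heis_bracket \<eta> k))" for t k
    using frechet_derivative_at[OF left_inv_field_has_derivative[of a t k]]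
    by (simp add: one_osc_group)
  have half: "(1/2) *\<^sub>R z + (1/2) *\<^sub>R z = z" for z :: "'a heis"
    by (simp add: scaleR_left_distrib[symmetric])
  show "lie_bracket (osc_group a) v w = osc_bracket a v w"
    unfolding lie_bracket_def one
    by (simp add: vw der osc_bracket_def anti algebra_simps half)
qed

lemma osc_bracket_basis:
  fixes a :: "real^'n::finite"
  defines "A \<equiv> (1, 0, 0, 0)" and "B \<equiv> (0, 1, 0, 0)"
    and "e \<equiv> \<lambda>i. (0, 0, axis i 1, 0)" and "f \<equiv> \<lambda>i. (0, 0, 0, axis i 1)"
  shows "osc_bracket a A B = 0" "osc_bracket a A (e i) = a$i *\<^sub>R f i"
    "osc_bracket a A (f i) = - a$i *\<^sub>R e i"
    "osc_bracket a (e i) (f j) = (if i = j then B else 0)"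
    "osc_bracket a (e i) (e j) = 0" "osc_bracket a (f i) (f j) = 0"
    "osc_bracket a B (e i) = 0" "osc_bracket a B (f i) = 0"
  by (simp_all add: A_def B_def e_def f_def osc_bracket_def osc_deriv_def heis_bracket_def
      inner_axis_axis zero_prod_def) (auto simp: vec_eq_iff axis_def)

end

theory Submission
  imports Defs
begin

text \<open>
  Take the inner product for which \<open>A, B, e\<^sub>i, f\<^sub>i\<close> is orthonormal, \<open>J A = B\<close> and \<open>J e\<^sub>i = f\<^sub>i\<close>. Then
  \<open>\<omega> = A\<^sup>* \<and> B\<^sup>* + \<Sum>\<^sub>i e\<^sub>i\<^sup>* \<and> f\<^sub>i\<^sup>*\<close>; since \<open>dA\<^sup>* = 0\<close>, \<open>dB\<^sup>* = - \<Sum>\<^sub>i e\<^sub>i\<^sup>* \<and> f\<^sub>i\<^sup>*\<close> and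
  \<open>D\<close> preserves \<open>\<Sum>\<^sub>i e\<^sub>i\<^sup>* \<and> f\<^sub>i\<^sup>*\<close>, this gives \<open>d\<omega> = A\<^sup>* \<and> \<omega>\<close>. The Lee form \<open>A\<^sup>*\<close> is parallel
  because \<open>ad A\<close> is skew-symmetric. Left invariant tensors descend to every quotient \<open>\<Gamma>\G\<close>.
\<close>

text \<open>Left translations by \<Gamma> preserve left invariant fields, so moving tangent vectors
  back to the identity gives the same Lie algebra vector for every member of an orbit. This is what
  lets \<open>J\<close> and \<open>ip\<close> descend.\<close>

lemma invariant_vaisman_structure_exists:
  fixes G :: "('g::real_normed_vector, 'b) monoid_scheme"
  assumes G: "group G" and \<Gamma>: "subgroup \<Gamma> G"
    and V: "vaisman_structure (lie_bracket G) J ip"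
    and one: "\<And>x. left_inv_field G x \<one>\<^bsub>G\<^esub> = x"
    and transl: "\<And>p q x. p \<in> carrier G \<Longrightarrow> q \<in> carrier G \<Longrightarrow>
      left_transl_deriv G p q (left_inv_field G x q) = left_inv_field G x (p \<otimes>\<^bsub>G\<^esub> q)"
  shows "\<exists>JQ gQ. invariant_vaisman_structure G \<Gamma> JQ gQ"
proof -
  interpret group G by fact
  let ?L = "left_inv_field G" and ?T = "quotient_tangent G \<Gamma>"
  \<comment> \<open>The left Maurer-Cartan form: \<open>v\<close> is translated from
    \<open>p\<close> back to the identity.\<close>
  define coord where "coord = (\<lambda>(p, v). left_transl_deriv G (inv\<^bsub>G\<^esub> p) p v)"
  have coord: "coord (p, ?L x p) = x" if "p \<in> carrier G" for p x
    using that by (simp add: coord_def transl one)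
  have T: "?T p (?L x p) = (\<lambda>\<gamma>. (\<gamma> \<otimes>\<^bsub>G\<^esub> p, ?L x (\<gamma> \<otimes>\<^bsub>G\<^esub> p))) ` \<Gamma>"
    if "p \<in> carrier G" for p x
    unfolding quotient_tangent_def
    using that subgroup.mem_carrier[OF \<Gamma>] by (intro image_cong) (simp_all add: transl)
  have coord_T: "coord w = x" if "p \<in> carrier G" "w \<in> ?T p (?L x p)" for p x w
    using that subgroup.mem_carrier[OF \<Gamma>] by (auto simp: T coord)
  \<comment> \<open>The choice is harmless: by \<open>coord_T\<close>, \<open>coord\<close> is
    constant on each orbit.\<close>
  define vec where "vec = (\<lambda>S. coord (SOME w. w \<in> S))"
  have vec: "vec (?T p (?L x p)) = x" if p: "p \<in> carrier G" for p x
  proof -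
    have "\<exists>w. w \<in> ?T p (?L x p)"
      using subgroup.one_closed[OF \<Gamma>] by (auto simp: quotient_tangent_def)
    then show ?thesis
      unfolding vec_def by (rule coord_T[OF p someI_ex])
  qed
  \<comment> \<open>Acting on every member of the orbit, with base points kept, yields a whole orbit
    again.\<close>
  define JQ where "JQ = (\<lambda>S. (\<lambda>w. (fst w, ?L (J (coord w)) (fst w))) ` S)"
  have JQ: "JQ (?T p (?L x p)) = ?T p (?L (J x) p)" if "p \<in> carrier G" for p x
    unfolding JQ_def T[OF that] image_image
    using that subgroup.mem_carrier[OF \<Gamma>] by (intro image_cong) (simp_all add: coord)
  have "invariant_vaisman_structure G \<Gamma> JQ (\<lambda>S S'. ip (vec S) (vec S'))"
    unfolding invariant_vaisman_structure_def using V JQ vec by auto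
  then show ?thesis by blast
qed

lemma left_inv_field_osc_group_one: "left_inv_field (osc_group a) x \<one>\<^bsub>osc_group a\<^esub> = x"
  by (cases x) (simp add: left_inv_field_def one_osc_group zero_prod_def
      left_transl_deriv_osc_group heis_bracket_def split: prod.splits)

text \<open>The chain rule for the composite of left translations by \<open>q\<close> and then
  \<open>p\<close>, checked in coordinates.\<close>

lemma left_transl_deriv_left_inv_field_osc_group:
  "left_transl_deriv (osc_group a) p q (left_inv_field (osc_group a) x q) =
     left_inv_field (osc_group a) x (p \<otimes>\<^bsub>osc_group a\<^esub> q)"
proof -
  obtain s h s' h' t k where [simp]: "p = (s, h)" "q = (s', h')" "x = (t, k)"
    by (metis surj_pair)
  \<comment> \<open>Two-step nilpotency kills the iterated brackets, which arise from the composed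
    derivatives on one side and from \<open>heis_mult\<close> on the other.\<close>
  have nil: "heis_bracket u (heis_bracket v w) = 0" "heis_bracket (heis_bracket v w) u = 0"
    for u v w :: "'a heis"
    by (cases u; cases v; cases w; simp add: heis_bracket_def zero_prod_def)+
  have lin: "heis_bracket u (v + w) = heis_bracket u v + heis_bracket u w"
    "heis_bracket (v + w) u = heis_bracket v u + heis_bracket w u"
    "heis_bracket u (r *\<^sub>R v) = r *\<^sub>R heis_bracket u v"
    "heis_bracket (r *\<^sub>R v) u = r *\<^sub>R heis_bracket v u"
    for u v w :: "'a heis" and r
    by (rule bilinear_radd bilinear_ladd bilinear_rmul bilinear_lmul, rule bilinear_heis_bracket)+
  show ?thesis
    by (simp add: left_inv_field_def left_transl_deriv_osc_group mult_osc_group heis_mult_def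
        linear_add[OF linear_osc_exp] linear_cmul[OF linear_osc_exp]
        osc_exp_heis_bracket[symmetric] osc_exp_add lin nil algebra_simps)
qed

definition osc_J :: "real \<times> 'n::finite heis \<Rightarrow> real \<times> 'n heis" where
  "osc_J = (\<lambda>(s, b, x, y). (- b, s, - y, x))"

text \<open>The value given by the Koszul formula.\<close>

definition osc_nabla ::
  "real^'n::finite \<Rightarrow> real \<times> 'n heis \<Rightarrow> real \<times> 'n heis \<Rightarrow> real \<times> 'n heis" where
  "osc_nabla a = (\<lambda>(s, b, x, y) (t, c, u, v).
     (0, s *\<^sub>R osc_deriv a (c, u, v)
       + (1/2) *\<^sub>R (x \<bullet> v - y \<bullet> u, b *\<^sub>R v + c *\<^sub>R y, - (b *\<^sub>R u + c *\<^sub>R x))))"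

text \<open>On the span of the e_i and f_i, D commutes with \<open>osc_J\<close> and the Heisenberg
  bracket is \<open>osc_J\<close>-invariant; B is central. Hence the Nijenhuis tensor
  vanishes.\<close>

lemma complex_structure_osc_J: "complex_structure (osc_bracket a) osc_J"
  unfolding complex_structure_def
  by (auto simp: osc_J_def osc_bracket_def osc_deriv_def heis_bracket_def vec_eq_iff zero_prod_def
      inner_commute algebra_simps intro!: linearI)

text \<open>D is a_i times a quarter turn on each plane spanned by e_i and f_i.\<close>

lemma inner_osc_deriv: "osc_deriv a h \<bullet> k = - (h \<bullet> osc_deriv a k)"
  by (cases h; cases k)
    (simp add: osc_deriv_def inner_vec_def sum_negf[symmetric] sum.distrib[symmetric] algebra_simps)

lemma levi_civita_osc_nabla: "levi_civita (osc_bracket a) (\<bullet>) (osc_nabla a)"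
  unfolding levi_civita_def
proof (intro conjI allI)
  fix x y z :: "real \<times> 'a heis"
  obtain s b u v t c u' v' r d u'' v'' where
    [simp]: "x = (s, b, u, v)" "y = (t, c, u', v')" "z = (r, d, u'', v'')"
    by (metis prod_cases4)
  show "linear (osc_nabla a x)" "linear (\<lambda>x. osc_nabla a x y)"
    by (auto simp: osc_nabla_def osc_deriv_def vec_eq_iff inner_simps algebra_simps
        add_divide_distrib diff_divide_distrib intro!: linearI)
  show "osc_nabla a x y - osc_nabla a y x = osc_bracket a x y"
    by (simp add: osc_nabla_def osc_bracket_def osc_deriv_def heis_bracket_def vec_eq_iff
        inner_commute field_simps)
  \<comment> \<open>In the metric condition the terms with factor 1/2 cancel in pairs; what remains
    is the skew-symmetry of \<open>s\<close> times D.\<close>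
  have "osc_deriv a (c, u', v') \<bullet> (d, u'', v'') + (c, u', v') \<bullet> osc_deriv a (d, u'', v'') = 0"
    by (simp add: inner_osc_deriv)
  then have "s * (osc_deriv a (c, u', v') \<bullet> (d, u'', v''))
      + s * ((c, u', v') \<bullet> osc_deriv a (d, u'', v'')) = 0"
    by (simp add: distrib_left[symmetric])
  then show "osc_nabla a x y \<bullet> z + y \<bullet> osc_nabla a x z = 0"
    by (simp add: osc_nabla_def inner_simps inner_commute algebra_simps)
qed

lemma ce_d2_osc_bracket:
  "ce_d2 (osc_bracket a) (\<lambda>x y. osc_J x \<bullet> y) x y z = wedge12 fst (\<lambda>x y. osc_J x \<bullet> y) x y z"
proof -
  obtain s b u v t c u' v' r d u'' v'' where
    [simp]: "x = (s, b, u, v)" "y = (t, c, u', v')" "z = (r, d, u'', v'')"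
    by (metis prod_cases4)
  \<comment> \<open>D has off-diagonal blocks \<open>- M\<close> and \<open>M\<close>.
    Self-adjointness of \<open>M\<close> makes the D-terms of the differential cancel.\<close>
  define M where "M = (\<lambda>w. \<chi> i. a$i * w$i)"
  have M: "M w \<bullet> w' = w \<bullet> M w'" for w w'
    by (simp add: M_def inner_vec_def mult_ac)
  have M_commute: "w \<bullet> M w' = w' \<bullet> M w" for w w'
    using M inner_commute by metis
  have D: "osc_deriv a (b, w, w') = (0, - M w', M w)" for b w w'
    by (simp add: osc_deriv_def M_def vec_eq_iff)
  show ?thesis
    by (simp add: ce_d2_def wedge12_def osc_J_def osc_bracket_def D heis_bracket_def
        inner_simps M M_commute algebra_simps)
qed

lemma vaisman_structure_osc: "vaisman_structure (osc_bracket a) osc_J (\<bullet>)"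
  unfolding vaisman_structure_def Let_def
\<comment> \<open>The Lee form \<open>fst\<close> is the dual form of A. It is closed and parallel
  because \<open>osc_bracket\<close> and \<open>osc_nabla\<close> take values in its kernel, the
  Heisenberg ideal.\<close>
proof (intro conjI exI[of _ fst] allI)
  show "inner_product_on ((\<bullet>) :: real \<times> 'a heis \<Rightarrow> _)"
    by (simp add: inner_product_on_def inner_commute bounded_linear.linear bounded_linear_inner_right)
  show "osc_J x \<bullet> osc_J y = x \<bullet> y" for x y :: "real \<times> 'a heis"
    by (simp add: osc_J_def split: prod.splits)
  show "linear (fst :: real \<times> 'a heis \<Rightarrow> _)"
    by (rule linear_fst)
  show "\<exists>x :: real \<times> 'a heis. fst x \<noteq> 0"
    by (auto intro: exI[of _ "(1, 0)"])
  show "ce_d1 (osc_bracket a) fst x y = 0" for x y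
    by (simp add: ce_d1_def osc_bracket_def split: prod.splits)
  have "- fst (osc_nabla a x y) = 0" for x y
    by (simp add: osc_nabla_def split: prod.splits)
  then show "\<exists>nabla. levi_civita (osc_bracket a) (\<bullet>) nabla \<and> (\<forall>x y. - fst (nabla x y) = 0)"
    using levi_civita_osc_nabla by blast
qed (rule complex_structure_osc_J ce_d2_osc_bracket)+

theorem theorem6p2:
  fixes a :: "real^'n::{finite,linorder}"
  assumes "mono (\<lambda>i. a$i)"
  shows "(a \<noteq> 0 \<longrightarrow> (\<forall>\<Gamma>. cocompact_lattice (osc_group a) \<Gamma> \<longrightarrow>
            (\<exists>JQ gQ. invariant_vaisman_structure (osc_group a) \<Gamma> JQ gQ))) \<and>
         ((\<forall>i. 0 < a$i) \<longrightarrow> (\<forall>\<Gamma>. cocompact_lattice (osc_group a) \<Gamma> \<longrightarrow>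
            (\<exists>JQ gQ. invariant_vaisman_structure (osc_group a) \<Gamma> JQ gQ)))"
proof -
  have "\<exists>JQ gQ. invariant_vaisman_structure (osc_group a) \<Gamma> JQ gQ"
    if "cocompact_lattice (osc_group a) \<Gamma>" for \<Gamma>
  proof (rule invariant_vaisman_structure_exists[OF group_osc_group])
    show "subgroup \<Gamma> (osc_group a)"
      using that by (simp add: cocompact_lattice_def)
    show "vaisman_structure (lie_bracket (osc_group a)) osc_J (\<bullet>)"
      unfolding lie_bracket_osc_group by (rule vaisman_structure_osc)
  qed (rule left_inv_field_osc_group_one left_transl_deriv_left_inv_field_osc_group)+
  then show ?thesis by blast
qed

end
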